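(* Let $(\mathcal R,\exp)$ be an exponential field which, as a structure in the language $\mathcal L_{OR}(\exp)=(+,\cdot,0,1,\leqslant,\exp)$, is a model of the complete theory $Th(\mathbb R_{\exp_2})$ of $\mathbb R_{\exp_2}=(\mathbb R,+,\cdot,0,1,\leqslant,2^x)$. Let $\mathcal M\subseteq\mathcal R$ be a discretely ordered ring such that $(\mathcal M,\exp)$ is an exponential integer part of $(\mathcal R,\exp)$. Then $(\mathcal M^+,\exp|_{M^+})$, with $S(x)$ interpreted as $x+1$, is a model of $\mathsf{IOpen}(\exp)$.
   Context: An exponential field is an ordered field $\mathcal F$ together with a map $\exp\colon F\to F^{>0}$ which is an order-preserving isomorphism from $(F,+)$ onto $(F^{>0},\cdot)$. A discretely ordered ring is an ordered (commutative unital) ring in which $1$ is the least positive element. For an ordered ring $\mathcal M$, $M^+=\{m\in M: m\geqslant 0\}$ and $\mathcal M^+$ is the semiring of nonnegative elements. If $\mathcal M\subseteq \mathcal R$ are ordered rings with $\mathcal M$ discretely ordered, $\mathcal M$ is an integer part of $\mathcal R$ if for every $r\in R$ there is $m\in M$ with $m\leqslant r<m+1$. $(\mathcal M,\exp)$ is an exponential integer part of $(\mathcal R,\exp)$ if $\mathcal M$ is an integer part of $\mathcal R$ and $\exp(m)\in M^+$ for all $m\in M^+$. The theory $\mathsf{IOpen}(\exp)$ is formulated in the language $(0,S,+,\cdot,\leqslant,\exp)$ and consists of: (Q1) $Sx\neq 0$; (Q2) $Sx=Sy\to x=y$; (Q3) $x\neq 0\to\exists y\,(x=Sy)$; (Q4)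 $x+0=x$; (Q5) $x+Sy=S(x+y)$; (Q6) $x\cdot 0=0$; (Q7) $x\cdot Sy=x\cdot y+x$; (Q8) $x\leqslant y\leftrightarrow\exists r\,(r+x=y)$; (E1) $\exp(0)=S(0)$; (E2) $\exp(S(x))=\exp(x)+\exp(x)$; and the induction scheme $\big(\varphi(0,\bar y)\wedge\forall x(\varphi(x,\bar y)\to\varphi(S(x),\bar y))\big)\to\forall x\,\varphi(x,\bar y)$ for every quantifier-free formula $\varphi$ of the language $(0,S,+,\cdot,\leqslant,\exp)$. *)

theory Defs
  imports Complex_Main
begin

section \<open>First-order logic over languages with \<open>+\<close>, \<open>\<cdot>\<close>, \<open>\<le>\<close>\<close>

text \<open>
  Both languages below contain the binary symbols \<open>+\<close>, \<open>\<cdot>\<close>, \<open>\<le>\<close>; they differ only in their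
  constants (type \<open>'c\<close>) and unary function symbols (type \<open>'u\<close>).
\<close>

datatype ('c, 'u) trm =
    Var nat
  | Cst 'c
  | App 'u "('c, 'u) trm"
  | Add "('c, 'u) trm" "('c, 'u) trm"
  | Mul "('c, 'u) trm" "('c, 'u) trm"

datatype ('c, 'u) fm =
    Eq "('c, 'u) trm" "('c, 'u) trm"
  | Le "('c, 'u) trm" "('c, 'u) trm"
  | Neg "('c, 'u) fm"
  | Conj "('c, 'u) fm" "('c, 'u) fm"
  | Disj "('c, 'u) fm" "('c, 'u) fm"
  | Imp "('c, 'u) fm" "('c, 'u) fm"
  | All nat "('c, 'u) fm"
  | Ex nat "('c, 'u) fm"

abbreviation Iff :: "('c, 'u) fm \<Rightarrow> ('c, 'u) fm \<Rightarrow> ('c, 'u) fm" where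
  "Iff p q \<equiv> Conj (Imp p q) (Imp q p)"

primrec vars_trm :: "('c, 'u) trm \<Rightarrow> nat set" where
  "vars_trm (Var n) = {n}"
| "vars_trm (Cst c) = {}"
| "vars_trm (App u t) = vars_trm t"
| "vars_trm (Add s t) = vars_trm s \<union> vars_trm t"
| "vars_trm (Mul s t) = vars_trm s \<union> vars_trm t"

primrec free_vars :: "('c, 'u) fm \<Rightarrow> nat set" where
  "free_vars (Eq s t) = vars_trm s \<union> vars_trm t"
| "free_vars (Le s t) = vars_trm s \<union> vars_trm t"
| "free_vars (Neg p) = free_vars p"
| "free_vars (Conj p q) = free_vars p \<union> free_vars q"
| "free_vars (Disj p q) = free_vars p \<union> free_vars q"
| "free_vars (Imp p q) = free_vars p \<union> free_vars q"
| "free_vars (All n p) = free_vars p - {n}"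
| "free_vars (Ex n p) = free_vars p - {n}"

definition sentence :: "('c, 'u) fm \<Rightarrow> bool" where
  "sentence p \<longleftrightarrow> free_vars p = {}"

primrec quantifier_free :: "('c, 'u) fm \<Rightarrow> bool" where
  "quantifier_free (Eq s t) \<longleftrightarrow> True"
| "quantifier_free (Le s t) \<longleftrightarrow> True"
| "quantifier_free (Neg p) \<longleftrightarrow> quantifier_free p"
| "quantifier_free (Conj p q) \<longleftrightarrow> quantifier_free p \<and> quantifier_free q"
| "quantifier_free (Disj p q) \<longleftrightarrow> quantifier_free p \<and> quantifier_free q"
| "quantifier_free (Imp p q) \<longleftrightarrow> quantifier_free p \<and> quantifier_free q"
| "quantifier_free (All n p) \<longleftrightarrow> False"
| "quantifier_free (Ex n p) \<longleftrightarrow> False"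

primrec subst_trm :: "nat \<Rightarrow> ('c, 'u) trm \<Rightarrow> ('c, 'u) trm \<Rightarrow> ('c, 'u) trm" where
  "subst_trm x r (Var n) = (if n = x then r else Var n)"
| "subst_trm x r (Cst c) = Cst c"
| "subst_trm x r (App u t) = App u (subst_trm x r t)"
| "subst_trm x r (Add s t) = Add (subst_trm x r s) (subst_trm x r t)"
| "subst_trm x r (Mul s t) = Mul (subst_trm x r s) (subst_trm x r t)"

text \<open>
  Substitution of the term \<open>r\<close> for the free occurrences of \<open>x\<close>. Variable capture is not avoided
  under quantifiers, which is harmless because it is only applied to quantifier-free formulas.
\<close>

primrec subst :: "nat \<Rightarrow> ('c, 'u) trm \<Rightarrow> ('c, 'u) fm \<Rightarrow> ('c, 'u) fm" where
  "subst x r (Eq s t) = Eq (subst_trm x r s) (subst_trm x r t)"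
| "subst x r (Le s t) = Le (subst_trm x r s) (subst_trm x r t)"
| "subst x r (Neg p) = Neg (subst x r p)"
| "subst x r (Conj p q) = Conj (subst x r p) (subst x r q)"
| "subst x r (Disj p q) = Disj (subst x r p) (subst x r q)"
| "subst x r (Imp p q) = Imp (subst x r p) (subst x r q)"
| "subst x r (All n p) = All n (if n = x then p else subst x r p)"
| "subst x r (Ex n p) = Ex n (if n = x then p else subst x r p)"

text \<open>
  The operations are total functions on the ambient type; only their values on the universe
  matter, and \<open>is_structure\<close> demands that the universe be closed under them.
\<close>

record ('a, 'c, 'u) fo_struct =
  universe :: "'a set"
  cst :: "'c \<Rightarrow> 'a"
  app :: "'u \<Rightarrow> 'a \<Rightarrow> 'a"
  add :: "'a \<Rightarrow> 'a \<Rightarrow> 'a"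
  mul :: "'a \<Rightarrow> 'a \<Rightarrow> 'a"
  le :: "'a \<Rightarrow> 'a \<Rightarrow> bool"

definition is_structure :: "('a, 'c, 'u) fo_struct \<Rightarrow> bool" where
  "is_structure A \<longleftrightarrow>
     universe A \<noteq> {} \<and>
     (\<forall>c. cst A c \<in> universe A) \<and>
     (\<forall>u. \<forall>x\<in>universe A. app A u x \<in> universe A) \<and>
     (\<forall>x\<in>universe A. \<forall>y\<in>universe A. add A x y \<in> universe A \<and> mul A x y \<in> universe A)"

primrec val :: "('a, 'c, 'u) fo_struct \<Rightarrow> (nat \<Rightarrow> 'a) \<Rightarrow> ('c, 'u) trm \<Rightarrow> 'a" where
  "val A e (Var n) = e n"
| "val A e (Cst c) = cst A c"
| "val A e (App u t) = app A u (val A e t)"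
| "val A e (Add s t) = add A (val A e s) (val A e t)"
| "val A e (Mul s t) = mul A (val A e s) (val A e t)"

primrec sat :: "('a, 'c, 'u) fo_struct \<Rightarrow> (nat \<Rightarrow> 'a) \<Rightarrow> ('c, 'u) fm \<Rightarrow> bool" where
  "sat A e (Eq s t) \<longleftrightarrow> val A e s = val A e t"
| "sat A e (Le s t) \<longleftrightarrow> le A (val A e s) (val A e t)"
| "sat A e (Neg p) \<longleftrightarrow> \<not> sat A e p"
| "sat A e (Conj p q) \<longleftrightarrow> sat A e p \<and> sat A e q"
| "sat A e (Disj p q) \<longleftrightarrow> sat A e p \<or> sat A e q"
| "sat A e (Imp p q) \<longleftrightarrow> (sat A e p \<longrightarrow> sat A e q)"
| "sat A e (All n p) \<longleftrightarrow> (\<forall>a\<in>universe A. sat A (e(n := a)) p)"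
| "sat A e (Ex n p) \<longleftrightarrow> (\<exists>a\<in>universe A. sat A (e(n := a)) p)"

text \<open>Truth in a structure: free variables are read as universally quantified.\<close>

definition true_in :: "('a, 'c, 'u) fo_struct \<Rightarrow> ('c, 'u) fm \<Rightarrow> bool" where
  "true_in A p \<longleftrightarrow> (\<forall>e. range e \<subseteq> universe A \<longrightarrow> sat A e p)"

definition is_model :: "('a, 'c, 'u) fo_struct \<Rightarrow> ('c, 'u) fm set \<Rightarrow> bool" where
  "is_model A T \<longleftrightarrow> is_structure A \<and> (\<forall>p\<in>T. true_in A p)"

definition complete_theory :: "('a, 'c, 'u) fo_struct \<Rightarrow> ('c, 'u) fm set" where
  "complete_theory A = {p. sentence p \<and> true_in A p}"


section \<open>Exponential fields and the language \<open>(+, \<cdot>, 0, 1, \<le>, exp)\<close>\<close>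

definition exponential_field :: "('a::linordered_field \<Rightarrow> 'a) \<Rightarrow> bool" where
  "exponential_field E \<longleftrightarrow>
     bij_betw E UNIV {0<..} \<and>
     (\<forall>x y. E (x + y) = E x * E y) \<and>
     (\<forall>x y. x \<le> y \<longleftrightarrow> E x \<le> E y)"

datatype or_const = OR_Zero | OR_One
datatype or_fun = OR_Exp

definition or_exp_struct :: "('a::linordered_field \<Rightarrow> 'a) \<Rightarrow> ('a, or_const, or_fun) fo_struct" where
  "or_exp_struct E =
     \<lparr> universe = UNIV,
       cst = (\<lambda>c. case c of OR_Zero \<Rightarrow> 0 | OR_One \<Rightarrow> 1),
       app = (\<lambda>u. case u of OR_Exp \<Rightarrow> E),
       add = (+), mul = (*), le = (\<le>) \<rparr>"

definition real_exp2 :: "(real, or_const, or_fun) fo_struct" where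
  "real_exp2 = or_exp_struct (\<lambda>x. 2 powr x)"


section \<open>Exponential integer parts\<close>

definition discretely_ordered_subring :: "'a::linordered_field set \<Rightarrow> bool" where
  "discretely_ordered_subring M \<longleftrightarrow>
     0 \<in> M \<and> 1 \<in> M \<and>
     (\<forall>x\<in>M. \<forall>y\<in>M. x + y \<in> M \<and> x * y \<in> M) \<and>
     (\<forall>x\<in>M. - x \<in> M) \<and>
     (\<forall>x\<in>M. 0 < x \<longrightarrow> 1 \<le> x)"

definition nonneg_part :: "'a::linordered_field set \<Rightarrow> 'a set" where
  "nonneg_part M = {m \<in> M. 0 \<le> m}"

text \<open>
  The next two notions are meant for discretely ordered subrings \<open>M\<close>; this is a separate hypothesis.
\<close>

definition integer_part :: "'a::linordered_field set \<Rightarrow> bool" where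
  "integer_part M \<longleftrightarrow> (\<forall>r. \<exists>m\<in>M. m \<le> r \<and> r < m + 1)"

definition exponential_integer_part :: "'a::linordered_field set \<Rightarrow> ('a \<Rightarrow> 'a) \<Rightarrow> bool" where
  "exponential_integer_part M E \<longleftrightarrow>
     integer_part M \<and> (\<forall>m\<in>nonneg_part M. E m \<in> nonneg_part M)"


section \<open>The theory \<open>IOpen(exp)\<close> in the language \<open>(0, S, +, \<cdot>, \<le>, exp)\<close>\<close>

datatype ar_const = AR_Zero
datatype ar_fun = AR_Succ | AR_Exp

type_synonym ar_trm = "(ar_const, ar_fun) trm"
type_synonym ar_fm = "(ar_const, ar_fun) fm"

abbreviation Zr :: ar_trm where "Zr \<equiv> Cst AR_Zero"
abbreviation Sc :: "ar_trm \<Rightarrow> ar_trm" where "Sc t \<equiv> App AR_Succ t"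
abbreviation Xp :: "ar_trm \<Rightarrow> ar_trm" where "Xp t \<equiv> App AR_Exp t"

text \<open>In the axioms below, \<open>Var 0\<close> is \<open>x\<close>, \<open>Var 1\<close> is \<open>y\<close> and \<open>Var 2\<close> is \<open>r\<close>.\<close>

definition Q1 :: ar_fm where "Q1 = Neg (Eq (Sc (Var 0)) Zr)"
definition Q2 :: ar_fm where
  "Q2 = Imp (Eq (Sc (Var 0)) (Sc (Var 1))) (Eq (Var 0) (Var 1))"
definition Q3 :: ar_fm where
  "Q3 = Imp (Neg (Eq (Var 0) Zr)) (Ex 1 (Eq (Var 0) (Sc (Var 1))))"
definition Q4 :: ar_fm where "Q4 = Eq (Add (Var 0) Zr) (Var 0)"
definition Q5 :: ar_fm where
  "Q5 = Eq (Add (Var 0) (Sc (Var 1))) (Sc (Add (Var 0) (Var 1)))"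
definition Q6 :: ar_fm where "Q6 = Eq (Mul (Var 0) Zr) Zr"
definition Q7 :: ar_fm where
  "Q7 = Eq (Mul (Var 0) (Sc (Var 1))) (Add (Mul (Var 0) (Var 1)) (Var 0))"
definition Q8 :: ar_fm where
  "Q8 = Iff (Le (Var 0) (Var 1)) (Ex 2 (Eq (Add (Var 2) (Var 0)) (Var 1)))"
definition E1 :: ar_fm where "E1 = Eq (Xp Zr) (Sc Zr)"
definition E2 :: ar_fm where
  "E2 = Eq (Xp (Sc (Var 0))) (Add (Xp (Var 0)) (Xp (Var 0)))"

definition induction_axiom :: "nat \<Rightarrow> ar_fm \<Rightarrow> ar_fm" where
  "induction_axiom x p =
     Imp (Conj (subst x Zr p) (All x (Imp p (subst x (Sc (Var x)) p)))) (All x p)"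

definition IOpen_exp :: "ar_fm set" where
  "IOpen_exp =
     {Q1, Q2, Q3, Q4, Q5, Q6, Q7, Q8, E1, E2} \<union>
     {induction_axiom x p | x p. quantifier_free p}"

definition nonneg_exp_struct ::
    "'a::linordered_field set \<Rightarrow> ('a \<Rightarrow> 'a) \<Rightarrow> ('a, ar_const, ar_fun) fo_struct" where
  "nonneg_exp_struct M E =
     \<lparr> universe = nonneg_part M,
       cst = (\<lambda>c. case c of AR_Zero \<Rightarrow> 0),
       app = (\<lambda>u. case u of AR_Succ \<Rightarrow> (\<lambda>x. x + 1) | AR_Exp \<Rightarrow> E),
       add = (+), mul = (*), le = (\<le>) \<rparr>"

end

(* For a term t the function x |-> t(x, e) lies in a ring of smooth functions built from the
   polynomials by successively adjoining exponentials of elements. Induction on the degree in the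
   last exponential, with Rolle's theorem, bounds the number of sign changes uniformly in the
   parameters e. Hence a quantifier-free formula has constant truth value off at most N points, with
   N independent of e; this is a first-order statement and transfers to R. If p fails at a
   nonnegative element of M, then it fails one step below, and stepping just below the integer part
   of the last exceptional point leaves fewer exceptional points below the failure: a descent that
   must stop. *)

theory Submission
  imports Defs "HOL-Computational_Algebra.Polynomial"
begin

section \<open>Functions that are constant off a finite set\<close>

text \<open>Constancy is asked only on closed intervals that miss \<open>S\<close>. This involves
  nothing but the order, so for truth values of formulas it makes sense in a non-Archimedean field
  and is first-order once the points of \<open>S\<close> are named by variables.\<close>

definition const_off :: "'a::linorder set \<Rightarrow> ('a \<Rightarrow> 'b) \<Rightarrow> bool" where
  "const_off S f \<longleftrightarrow> (\<forall>u v. u \<le> v \<longrightarrow> {u..v} \<inter> S = {} \<longrightarrow> f u = f v)"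

lemma const_offD: "const_off S f \<Longrightarrow> u \<le> v \<Longrightarrow> {u..v} \<inter> S = {} \<Longrightarrow> f u = f v"
  by (auto simp: const_off_def)

lemma const_off_mono: "const_off S f \<Longrightarrow> S \<subseteq> T \<Longrightarrow> const_off T f"
  unfolding const_off_def by blast

lemma const_off_interval:
  assumes "const_off S f" "{u..v} \<inter> S = {}" "z \<in> {u..v}"
  shows "f z = f u"
proof -
  have "u \<le> z" "{u..z} \<subseteq> {u..v}" using assms(3) by auto
  moreover from this have "{u..z} \<inter> S = {}" using assms(2) by blast
  ultimately show ?thesis using const_offD[OF assms(1)] by metis
qed

lemma sgn_eq_if_no_zero:
  fixes f :: "real \<Rightarrow> real"
  assumes "u \<le> v" "continuous_on {u..v} f" "\<And>z. z \<in> {u..v} \<Longrightarrow> f z \<noteq> 0"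
  shows "sgn (f u) = sgn (f v)"
proof (rule ccontr)
  assume "sgn (f u) \<noteq> sgn (f v)"
  moreover have "f u \<noteq> 0" "f v \<noteq> 0" using assms by auto
  ultimately have "(f u \<le> 0 \<and> 0 \<le> f v) \<or> (f v \<le> 0 \<and> 0 \<le> f u)"
    by (auto simp: sgn_if split: if_splits)
  then obtain z where "z \<in> {u..v}" "f z = 0"
    using IVT'[of f u 0 v] IVT2'[of f v 0 u] assms(1,2) by auto
  with assms(3) show False by blast
qed

text \<open>The quotient \<open>y * f / a\<close> has derivative \<open>y * d / a\<^sup>2\<close> off the zeros of \<open>a\<close>, so by Rolle
  two zeros of \<open>a + y * f\<close> at which \<open>a\<close> and \<open>d\<close> do not vanish are separated by a point where
  \<open>a\<close> or \<open>d\<close> changes sign.\<close>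

lemma const_off_sgn_add_mult:
  fixes a f y d :: "real \<Rightarrow> real"
  assumes cont: "continuous_on UNIV (\<lambda>x. a x + y x * f x)"
    and pos: "\<And>x. y x > 0"
    and deriv: "\<And>x. a x \<noteq> 0 \<Longrightarrow>
      ((\<lambda>x. y x * f x / a x) has_real_derivative y x * d x / (a x)\<^sup>2) (at x)"
    and fin: "finite T"
    and T: "const_off T (\<lambda>x. sgn (a x))" "const_off T (\<lambda>x. sgn (f x))" "const_off T (\<lambda>x. sgn (d x))"
  shows "\<exists>S. finite S \<and> card S \<le> 2 * card T + 1 \<and> const_off S (\<lambda>x. sgn (a x + y x * f x))"
proof -
  let ?F = "\<lambda>x. a x + y x * f x" and ?h = "\<lambda>x. y x * f x / a x"
  \<comment> \<open>On an interval free of \<open>T\<close> on which \<open>a\<close> or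
    \<open>d\<close> vanishes the sign of \<open>?F\<close> cannot change, so only these remaining
    zeros have to join \<open>T\<close> as exceptional points.\<close>
  define Z where "Z = {z. a z \<noteq> 0 \<and> d z \<noteq> 0 \<and> ?F z = 0} - T"
  have F_eq: "?F z = a z * (1 + ?h z)" if "a z \<noteq> 0" for z
    using that by (simp add: field_simps)
  have nz: "a z \<noteq> 0" if "a u \<noteq> 0" "{u..v} \<inter> T = {}" "z \<in> {u..v}" for u v z
    using const_off_interval[OF T(1) that(2,3)] that(1) by (metis sgn_zero_iff)
  have nzd: "d z = 0 \<longleftrightarrow> d u = 0" if "{u..v} \<inter> T = {}" "z \<in> {u..v}" for u v z
    using const_off_interval[OF T(3) that] by (metis sgn_zero_iff)
  have sep: "{z..w} \<inter> T \<noteq> {}" if "z \<in> Z" "w \<in> Z" "z < w" for z w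
  proof
    assume disj: "{z..w} \<inter> T = {}"
    \<comment> \<open>Where \<open>a\<close> is nonzero, \<open>?F\<close> vanishes exactly when
      \<open>?h\<close> is -1; two points of \<open>Z\<close> therefore give \<open>?h\<close> equal
      end values, as Rolle requires.\<close>
    have "?h z = -1" "?h w = -1"
      using that F_eq[of z] F_eq[of w] by (auto simp: Z_def)
    moreover have D: "(?h has_real_derivative y x * d x / (a x)\<^sup>2) (at x)" if "x \<in> {z..w}" for x
      using deriv nz[OF _ disj that] \<open>z \<in> Z\<close> by (auto simp: Z_def)
    ultimately have "\<exists>l. z < l \<and> l < w \<and> y l * d l / (a l)\<^sup>2 = 0"
      using MVT2[of z w ?h "\<lambda>x. y x * d x / (a x)\<^sup>2"] \<open>z < w\<close> by auto
    then obtain l where "z < l" "l < w" and l0: "y l * d l / (a l)\<^sup>2 = 0" by blast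
    then have l: "l \<in> {z..w}" by simp
    have "y l \<noteq> 0" using pos[of l] by simp
    then show False
      using l0 nz[OF _ disj l] nzd[OF disj l] \<open>z \<in> Z\<close> by (auto simp: Z_def)
  qed
  \<comment> \<open>Any two elements of \<open>Z\<close> have a point of \<open>T\<close> between
    them, so counting the points of \<open>T\<close> to the left is injective on \<open>Z\<close>.
    The counts run from 0 to \<open>card T\<close>, whence at most \<open>card T + 1\<close>
    elements.\<close>
  define c where "c z = card {t \<in> T. t < z}" for z
  have "c z < c w" if "z \<in> Z" "w \<in> Z" "z < w" for z w
  proof -
    obtain t where "t \<in> T" "z \<le> t" "t \<le> w" using sep[OF \<open>z \<in> Z\<close> \<open>w \<in> Z\<close> \<open>z < w\<close>] by auto
    moreover have "w \<notin> T" using that by (simp add: Z_def)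
    ultimately have "t \<in> {t \<in> T. t < w} - {t \<in> T. t < z}" by (auto simp: less_le)
    moreover have "{t \<in> T. t < z} \<subseteq> {t \<in> T. t < w}" using \<open>z < w\<close> by auto
    ultimately have "{t \<in> T. t < z} \<subset> {t \<in> T. t < w}" by blast
    then show ?thesis unfolding c_def using fin by (intro psubset_card_mono) auto
  qed
  then have inj: "inj_on c Z" by (metis inj_onI less_irrefl linorder_neqE)
  have cZ: "c ` Z \<subseteq> {..card T}" unfolding c_def using fin by (auto intro: card_mono)
  have finZ: "finite Z" using inj cZ by (metis finite_atMost finite_imageD finite_subset)
  have "card Z \<le> card {..card T}" by (rule card_inj_on_le[OF inj cZ]) simp
  then have card: "card (T \<union> Z) \<le> 2 * card T + 1" using card_Un_le[of T Z] by simp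
  have "sgn (?F u) = sgn (?F v)" if uv: "u \<le> v" "{u..v} \<inter> (T \<union> Z) = {}" for u v
  proof -
    have disj: "{u..v} \<inter> T = {}" and v: "v \<in> {u..v}" using uv by auto
    have eqs: "sgn (a v) = sgn (a u)" "sgn (f v) = sgn (f u)"
      by (rule const_off_interval[OF T(1) disj v] const_off_interval[OF T(2) disj v])+
    \<comment> \<open>If \<open>a\<close> vanishes on the interval, the sign is that of
      \<open>f\<close>; if \<open>d\<close> does, \<open>?h\<close> is constant and hence so is the
      factor \<open>1 + ?h\<close>; otherwise no zero is left and the intermediate value theorem
      applies.\<close>
    consider "a u = 0" | "a u \<noteq> 0" "d u = 0" | "a u \<noteq> 0" "d u \<noteq> 0" by blast
    then show ?thesis
    proof cases
      case 1
      then have "a v = 0" using eqs(1) by (metis sgn_zero_iff)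
      with 1 eqs(2) show ?thesis using pos by (simp add: sgn_mult)
    next
      case 2
      have "(?h has_real_derivative 0) (at x)" if "x \<in> {u..v}" for x
        using deriv[OF nz[OF 2(1) disj that]] nzd[OF disj that] 2(2) by simp
      then have "\<forall>x. u \<le> x \<and> x \<le> v \<longrightarrow> (?h has_real_derivative 0) (at x)" by simp
      then have "?h v = ?h u" if "u < v"
        using MVT2[OF that, of ?h "\<lambda>_. 0"] by auto
      then have "?h v = ?h u" using uv(1) by (cases "u = v") auto
      then show ?thesis
        using F_eq[of u] F_eq[of v] nz[OF 2(1) disj] uv(1) eqs(1) by (simp add: sgn_mult)
    next
      case 3
      have "?F z \<noteq> 0" if "z \<in> {u..v}" for z
        using uv(2) that nz[OF 3(1) disj that] nzd[OF disj that] 3(2) by (auto simp: Z_def)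
      then show ?thesis
        by (intro sgn_eq_if_no_zero[of u v ?F] uv(1) continuous_on_subset[OF cont]) auto
    qed
  qed
  then show ?thesis
    using card fin finZ by (intro exI[of _ "T \<union> Z"]) (auto simp: const_off_def)
qed

section \<open>Differential rings of function families with uniformly bounded sign changes\<close>

text \<open>The index will be the assignment of the parameters. A bound independent of it is what
  allows finiteness of the exceptional set to be expressed by a single first-order formula.\<close>

definition uniformly_tame :: "('i \<Rightarrow> 'a::linorder \<Rightarrow> 'b) \<Rightarrow> bool" where
  "uniformly_tame F \<longleftrightarrow> (\<exists>N. \<forall>i. \<exists>S. finite S \<and> card S \<le> N \<and> const_off S (F i))"

lemma uniformly_tameE:
  assumes "uniformly_tame F"
  obtains N S where "\<And>i. finite (S i)" "\<And>i. card (S i) \<le> N" "\<And>i. const_off (S i) (F i)"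
  using assms unfolding uniformly_tame_def by metis

lemma uniformly_tame_comp: "uniformly_tame F \<Longrightarrow> uniformly_tame (\<lambda>i x. h (F i x))"
  unfolding uniformly_tame_def const_off_def by metis

lemma uniformly_tame_comp2:
  assumes "uniformly_tame F" "uniformly_tame G"
  shows "uniformly_tame (\<lambda>i x. h (F i x) (G i x))"
proof -
  obtain M S where S: "\<And>i. finite (S i)" "\<And>i. card (S i) \<le> M" "\<And>i. const_off (S i) (F i)"
    using assms(1) by (rule uniformly_tameE) blast
  obtain N T where T: "\<And>i. finite (T i)" "\<And>i. card (T i) \<le> N" "\<And>i. const_off (T i) (G i)"
    using assms(2) by (rule uniformly_tameE) blast
  have "const_off (S i \<union> T i) (\<lambda>x. h (F i x) (G i x))" for i
    using const_off_mono[OF S(3), of i "S i \<union> T i"] const_off_mono[OF T(3), of i "S i \<union> T i"]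
    by (auto simp: const_off_def)
  moreover have "card (S i \<union> T i) \<le> M + N" for i
    using card_Un_le[of "S i" "T i"] S(2)[of i] T(2)[of i] by linarith
  ultimately show ?thesis unfolding uniformly_tame_def
    using S(1) T(1) by (intro exI[of _ "M + N"] allI) (metis finite_UnI)
qed

text \<open>Closure under derivatives feeds the Rolle argument when an exponential is adjoined.
  Constants may vary with the index, so parameters act as coefficients.\<close>

definition tame_ring :: "('i \<Rightarrow> real \<Rightarrow> real) set \<Rightarrow> bool" where
  "tame_ring R \<longleftrightarrow>
     (\<forall>c. (\<lambda>i x. c i) \<in> R) \<and>
     (\<forall>f\<in>R. \<forall>g\<in>R. (\<lambda>i x. f i x + g i x) \<in> R \<and> (\<lambda>i x. f i x * g i x) \<in> R) \<and>
     (\<forall>f\<in>R. \<exists>f'\<in>R. \<forall>i x. (f i has_real_derivative f' i x) (at x)) \<and>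
     (\<forall>f\<in>R. uniformly_tame (\<lambda>i x. sgn (f i x)))"

lemma
  assumes "tame_ring R"
  shows tame_ring_const: "(\<lambda>i x. c i) \<in> R"
    and tame_ring_add: "f \<in> R \<Longrightarrow> g \<in> R \<Longrightarrow> (\<lambda>i x. f i x + g i x) \<in> R"
    and tame_ring_mult: "f \<in> R \<Longrightarrow> g \<in> R \<Longrightarrow> (\<lambda>i x. f i x * g i x) \<in> R"
    and tame_ring_tame: "f \<in> R \<Longrightarrow> uniformly_tame (\<lambda>i x. sgn (f i x))"
  using assms unfolding tame_ring_def by blast+

lemma tame_ring_deriv:
  assumes "tame_ring R" "f \<in> R"
  obtains f' where "f' \<in> R" "\<And>i x. (f i has_real_derivative f' i x) (at x)"
  using assms unfolding tame_ring_def by metis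

lemma tame_ring_uminus:
  assumes "tame_ring R" "f \<in> R"
  shows "(\<lambda>i x. - f i x) \<in> R"
  using tame_ring_mult[OF assms(1) tame_ring_const[OF assms(1), of "\<lambda>_. -1"] assms(2)] by simp

section \<open>The starting ring: polynomials of uniformly bounded degree\<close>

definition poly_families :: "('i \<Rightarrow> real \<Rightarrow> real) set" where
  "poly_families = {\<lambda>i. poly (p i) | p. \<exists>n. \<forall>i. degree (p i) \<le> n}"

lemma poly_familiesI: "(\<And>i. degree (p i) \<le> n) \<Longrightarrow> (\<lambda>i x. poly (p i) x) \<in> poly_families"
  unfolding poly_families_def by blast

lemma id_in_poly_families: "(\<lambda>i x. x) \<in> poly_families"
  using poly_familiesI[of "\<lambda>i. [:0, 1:]" 1] by simp

lemma tame_ring_poly_families: "tame_ring (poly_families :: ('i \<Rightarrow> real \<Rightarrow> real) set)"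
  unfolding tame_ring_def
proof (intro conjI allI ballI)
  show "(\<lambda>i x. c i) \<in> poly_families" for c :: "'i \<Rightarrow> real"
    using poly_familiesI[of "\<lambda>i. [:c i:]" 0] by simp
next
  fix f g :: "'i \<Rightarrow> real \<Rightarrow> real"
  assume "f \<in> poly_families" "g \<in> poly_families"
  then obtain p q m n where f: "f = (\<lambda>i. poly (p i))" "\<And>i. degree (p i) \<le> m"
    and g: "g = (\<lambda>i. poly (q i))" "\<And>i. degree (q i) \<le> n"
    by (auto simp: poly_families_def)
  have "degree (p i + q i) \<le> max m n" for i
    by (rule degree_add_le) (use f(2)[of i] g(2)[of i] in auto)
  then show "(\<lambda>i x. f i x + g i x) \<in> poly_families"
    using poly_familiesI[of "\<lambda>i. p i + q i" "max m n"] f(1) g(1) by (simp del: le_max_iff_disj)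
  have "degree (p i * q i) \<le> m + n" for i
    by (rule order_trans[OF degree_mult_le]) (use f(2)[of i] g(2)[of i] in auto)
  then show "(\<lambda>i x. f i x * g i x) \<in> poly_families"
    using poly_familiesI[of "\<lambda>i. p i * q i" "m + n"] f(1) g(1) by simp
next
  fix f :: "'i \<Rightarrow> real \<Rightarrow> real"
  assume "f \<in> poly_families"
  then obtain p m where f: "f = (\<lambda>i. poly (p i))" "\<And>i. degree (p i) \<le> m"
    by (auto simp: poly_families_def)
  have "degree (pderiv (p i)) \<le> m" for i
    using f(2)[of i] by (simp add: degree_pderiv)
  then have "(\<lambda>i x. poly (pderiv (p i)) x) \<in> poly_families" by (rule poly_familiesI)
  then show "\<exists>f'\<in>poly_families. \<forall>i x. (f i has_real_derivative f' i x) (at x)"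
    using f(1) by (force intro: poly_DERIV)
  show "uniformly_tame (\<lambda>i x. sgn (f i x))"
    unfolding uniformly_tame_def
  proof (intro exI[of _ m] allI)
    fix i
    show "\<exists>S. finite S \<and> card S \<le> m \<and> const_off S (\<lambda>x. sgn (f i x))"
    \<comment> \<open>The coefficients depend on \<open>i\<close>, so the polynomial may degenerate
      to zero for some indices; its root set is then infinite, but its sign is constant.\<close>
    proof (cases "p i = 0")
      case True
      then show ?thesis using f(1) by (intro exI[of _ "{}"]) (simp add: const_off_def)
    next
      case False
      have "const_off {x. poly (p i) x = 0} (\<lambda>x. sgn (f i x))"
        unfolding const_off_def f(1)
        by (intro allI impI sgn_eq_if_no_zero continuous_intros) auto
      then show ?thesis
        using False poly_roots_finite[OF False] card_poly_roots_bound[OF False] f(2)[of i]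
        by (intro exI[of _ "{x. poly (p i) x = 0}"]) (auto intro: order_trans)
    qed
  qed
qed

text \<open>Polynomials in \<open>exp g\<close> over \<open>R\<close> with at most \<open>n\<close>
  coefficients, in Horner form: passing from \<open>n\<close> to \<open>Suc n\<close> produces
  exactly the shape \<open>a + y * f\<close> treated by
  \<open>const_off_sgn_add_mult\<close>.\<close>

primrec adjoin_exp ::
    "('i \<Rightarrow> real \<Rightarrow> real) set \<Rightarrow> ('i \<Rightarrow> real \<Rightarrow> real) \<Rightarrow> nat \<Rightarrow> ('i \<Rightarrow> real \<Rightarrow> real) set" where
  "adjoin_exp R g 0 = {\<lambda>i x. 0}"
| "adjoin_exp R g (Suc n) = {\<lambda>i x. a i x + exp (g i x) * f i x | a f. a \<in> R \<and> f \<in> adjoin_exp R g n}"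

section \<open>Adjoining one exponential to a tame ring\<close>

context
  fixes R :: "('i \<Rightarrow> real \<Rightarrow> real) set" and g
  assumes R: "tame_ring R" and g: "g \<in> R"
begin

lemma adjoin_expI:
  "a \<in> R \<Longrightarrow> f \<in> adjoin_exp R g n \<Longrightarrow> (\<lambda>i x. a i x + exp (g i x) * f i x) \<in> adjoin_exp R g (Suc n)"
  by auto

lemma adjoin_exp_SucE:
  assumes "F \<in> adjoin_exp R g (Suc n)"
  obtains a f where "F = (\<lambda>i x. a i x + exp (g i x) * f i x)" "a \<in> R" "f \<in> adjoin_exp R g n"
  using assms by auto

lemma adjoin_exp_0: "(\<lambda>i x. 0) \<in> adjoin_exp R g n"
proof (induction n)
  case (Suc n)
  from adjoin_expI[OF tame_ring_const[OF R, of "\<lambda>_. 0"] this] show ?case by simp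
qed simp

lemma adjoin_exp_Suc: "f \<in> adjoin_exp R g n \<Longrightarrow> f \<in> adjoin_exp R g (Suc n)"
proof (induction n arbitrary: f)
  case 0
  then show ?case using adjoin_exp_0[of 1] by (simp del: adjoin_exp.simps(2))
next
  case (Suc n)
  obtain a h where f: "f = (\<lambda>i x. a i x + exp (g i x) * h i x)" "a \<in> R" "h \<in> adjoin_exp R g n"
    using Suc.prems by (rule adjoin_exp_SucE)
  show ?case unfolding f(1) by (rule adjoin_expI[OF f(2) Suc.IH[OF f(3)]])
qed

lemma adjoin_exp_mono: "m \<le> n \<Longrightarrow> adjoin_exp R g m \<subseteq> adjoin_exp R g n"
  by (rule lift_Suc_mono_le) (use adjoin_exp_Suc in blast)+

lemma adjoin_exp_add:
  "f \<in> adjoin_exp R g n \<Longrightarrow> h \<in> adjoin_exp R g n \<Longrightarrow> (\<lambda>i x. f i x + h i x) \<in> adjoin_exp R g n"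
proof (induction n arbitrary: f h)
  case (Suc n)
  obtain a f1 where f: "f = (\<lambda>i x. a i x + exp (g i x) * f1 i x)" "a \<in> R" "f1 \<in> adjoin_exp R g n"
    using Suc.prems(1) by (rule adjoin_exp_SucE)
  obtain b h1 where h: "h = (\<lambda>i x. b i x + exp (g i x) * h1 i x)" "b \<in> R" "h1 \<in> adjoin_exp R g n"
    using Suc.prems(2) by (rule adjoin_exp_SucE)
  show ?case
    using adjoin_expI[OF tame_ring_add[OF R f(2) h(2)] Suc.IH[OF f(3) h(3)]]
    by (simp add: f(1) h(1) algebra_simps del: adjoin_exp.simps)
qed simp

lemma adjoin_exp_scale:
  "a \<in> R \<Longrightarrow> f \<in> adjoin_exp R g n \<Longrightarrow> (\<lambda>i x. a i x * f i x) \<in> adjoin_exp R g n"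
proof (induction n arbitrary: f)
  case (Suc n)
  obtain b f1 where f: "f = (\<lambda>i x. b i x + exp (g i x) * f1 i x)" "b \<in> R" "f1 \<in> adjoin_exp R g n"
    using Suc.prems(2) by (rule adjoin_exp_SucE)
  show ?case
    using adjoin_expI[OF tame_ring_mult[OF R Suc.prems(1) f(2)] Suc.IH[OF Suc.prems(1) f(3)]]
    by (simp add: f(1) algebra_simps del: adjoin_exp.simps)
qed simp

lemma adjoin_exp_mult:
  "f \<in> adjoin_exp R g m \<Longrightarrow> h \<in> adjoin_exp R g n \<Longrightarrow> (\<lambda>i x. f i x * h i x) \<in> adjoin_exp R g (m + n)"
proof (induction m arbitrary: f)
  case 0
  then show ?case using adjoin_exp_0 by simp
next
  case (Suc m)
  obtain a f1 where f: "f = (\<lambda>i x. a i x + exp (g i x) * f1 i x)" "a \<in> R" "f1 \<in> adjoin_exp R g m"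
    using Suc.prems(1) by (rule adjoin_exp_SucE)
  have "(\<lambda>i x. a i x * h i x) \<in> adjoin_exp R g (Suc (m + n))"
    using adjoin_exp_scale[OF f(2) Suc.prems(2)] adjoin_exp_mono[of n "Suc (m + n)"] by auto
  from adjoin_exp_add[OF this adjoin_expI[OF tame_ring_const[OF R, of "\<lambda>_. 0"] Suc.IH[OF f(3) Suc.prems(2)]]]
  show ?case by (simp add: f(1) algebra_simps del: adjoin_exp.simps)
qed

text \<open>The derivative of \<open>exp g * f1\<close> is \<open>exp g * (g' * f1 + f1')\<close>,
  so differentiation does not raise the number of coefficients. This keeps the induction in
  \<open>adjoin_exp_tame\<close> at level \<open>n\<close>.\<close>

lemma adjoin_exp_deriv:
  "f \<in> adjoin_exp R g n \<Longrightarrow>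
     \<exists>f'\<in>adjoin_exp R g n. \<forall>i x. (f i has_real_derivative f' i x) (at x)"
proof (induction n arbitrary: f)
  case 0
  then show ?case by auto
next
  case (Suc n)
  obtain a f1 where f: "f = (\<lambda>i x. a i x + exp (g i x) * f1 i x)" "a \<in> R" "f1 \<in> adjoin_exp R g n"
    using Suc.prems by (rule adjoin_exp_SucE)
  obtain a' where a': "a' \<in> R" "\<And>i x. (a i has_real_derivative a' i x) (at x)"
    using tame_ring_deriv[OF R f(2)] by blast
  obtain g' where g': "g' \<in> R" "\<And>i x. (g i has_real_derivative g' i x) (at x)"
    using tame_ring_deriv[OF R g] by blast
  obtain f' where f': "f' \<in> adjoin_exp R g n" "\<And>i x. (f1 i has_real_derivative f' i x) (at x)"
    using Suc.IH[OF f(3)] by blast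
  define F' where "F' = (\<lambda>i x. a' i x + exp (g i x) * (g' i x * f1 i x + f' i x))"
  have "F' \<in> adjoin_exp R g (Suc n)" unfolding F'_def
    by (intro adjoin_expI adjoin_exp_add adjoin_exp_scale a' g' f f')
  moreover have "(f i has_real_derivative F' i x) (at x)" for i x
    unfolding f(1) F'_def
    by (rule derivative_eq_intros a'(2) g'(2) f'(2) refl)+ (simp add: algebra_simps)
  ultimately show ?case by blast
qed

text \<open>The numerator \<open>d\<close> of the derivative of \<open>exp g * f / a\<close> is
  built from \<open>f\<close>, its derivative and multipliers in \<open>R\<close>. It thus lies at
  level \<open>n\<close> together with \<open>f\<close>, and the induction hypothesis covers both,
  while \<open>a\<close> is tame as an element of \<open>R\<close>.\<close>

lemma adjoin_exp_tame: "F \<in> adjoin_exp R g n \<Longrightarrow> uniformly_tame (\<lambda>i x. sgn (F i x))"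
proof (induction n arbitrary: F)
  case 0
  then show ?case by (auto simp: uniformly_tame_def const_off_def)
next
  case (Suc n)
  obtain a f where F: "F = (\<lambda>i x. a i x + exp (g i x) * f i x)" "a \<in> R" "f \<in> adjoin_exp R g n"
    using Suc.prems by (rule adjoin_exp_SucE)
  obtain a' where a': "a' \<in> R" "\<And>i x. (a i has_real_derivative a' i x) (at x)"
    using tame_ring_deriv[OF R F(2)] by blast
  obtain g' where g': "g' \<in> R" "\<And>i x. (g i has_real_derivative g' i x) (at x)"
    using tame_ring_deriv[OF R g] by blast
  obtain f' where f': "f' \<in> adjoin_exp R g n" "\<And>i x. (f i has_real_derivative f' i x) (at x)"
    using adjoin_exp_deriv[OF F(3)] by blast
  define d where "d = (\<lambda>i x. a i x * (g' i x * f i x + f' i x) + - a' i x * f i x)"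
  have d: "d \<in> adjoin_exp R g n" unfolding d_def
    by (intro adjoin_exp_add adjoin_exp_scale F a' g' f' tame_ring_uminus[OF R])
  have deriv: "((\<lambda>x. exp (g i x) * f i x / a i x) has_real_derivative
      exp (g i x) * d i x / (a i x)\<^sup>2) (at x)" if "a i x \<noteq> 0" for i x
    by (rule derivative_eq_intros a'(2) g'(2) f'(2) refl that)+
      (simp add: d_def power2_eq_square algebra_simps)
  have cont: "continuous_on UNIV (F i)" for i
    using adjoin_exp_deriv[OF Suc.prems]
    by (meson DERIV_isCont continuous_at_imp_continuous_on)
  \<comment> \<open>Pairing the three signs yields one exceptional set that serves \<open>a\<close>,
    \<open>f\<close> and \<open>d\<close> at once.\<close>
  have "uniformly_tame (\<lambda>i x. (sgn (a i x), sgn (f i x), sgn (d i x)))"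
    by (rule uniformly_tame_comp2[where h = Pair, OF tame_ring_tame[OF R F(2)]
          uniformly_tame_comp2[where h = Pair, OF Suc.IH[OF F(3)] Suc.IH[OF d]]])
  then obtain N T where T: "\<And>i. finite (T i)" "\<And>i. card (T i) \<le> N"
      "\<And>i. const_off (T i) (\<lambda>x. (sgn (a i x), sgn (f i x), sgn (d i x)))"
    by (rule uniformly_tameE) blast
  have "\<exists>S. finite S \<and> card S \<le> 2 * card (T i) + 1 \<and> const_off S (\<lambda>x. sgn (F i x))" for i
    unfolding F(1)
    by (rule const_off_sgn_add_mult[where d = "d i"])
      (use T(1,3)[of i] deriv cont[of i, unfolded F(1)] in \<open>auto simp: const_off_def\<close>)
  moreover have "2 * card (T i) + 1 \<le> 2 * N + 1" for i using T(2)[of i] by simp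
  ultimately show ?case unfolding uniformly_tame_def
    by (intro exI[of _ "2 * N + 1"]) (blast intro: order_trans)
qed

lemma tame_ring_adjoin_exp: "tame_ring (\<Union>n. adjoin_exp R g n)"
  unfolding tame_ring_def
proof (intro conjI allI ballI)
  show "(\<lambda>i x. c i) \<in> (\<Union>n. adjoin_exp R g n)" for c
    using adjoin_expI[OF tame_ring_const[OF R] adjoin_exp_0, of c 0]
    by (auto simp del: adjoin_exp.simps)
next
  fix f h assume "f \<in> (\<Union>n. adjoin_exp R g n)" "h \<in> (\<Union>n. adjoin_exp R g n)"
  then obtain m n where mn: "f \<in> adjoin_exp R g m" "h \<in> adjoin_exp R g n" by blast
  then have "f \<in> adjoin_exp R g (m + n)" "h \<in> adjoin_exp R g (m + n)"
    using adjoin_exp_mono[of m "m + n"] adjoin_exp_mono[of n "m + n"] by auto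
  from adjoin_exp_add[OF this] show "(\<lambda>i x. f i x + h i x) \<in> (\<Union>n. adjoin_exp R g n)" by blast
  from adjoin_exp_mult[OF mn] show "(\<lambda>i x. f i x * h i x) \<in> (\<Union>n. adjoin_exp R g n)" by blast
next
  fix f assume "f \<in> (\<Union>n. adjoin_exp R g n)"
  then obtain n where n: "f \<in> adjoin_exp R g n" by blast
  from adjoin_exp_deriv[OF this]
  show "\<exists>f'\<in>\<Union>n. adjoin_exp R g n. \<forall>i x. (f i has_real_derivative f' i x) (at x)" by blast
  from adjoin_exp_tame[OF n] show "uniformly_tame (\<lambda>i x. sgn (f i x))" .
qed

lemma subset_adjoin_exp: "R \<subseteq> (\<Union>n. adjoin_exp R g n)"
proof
  fix a assume "a \<in> R"
  from adjoin_expI[OF this adjoin_exp_0, of 0] show "a \<in> (\<Union>n. adjoin_exp R g n)"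
    by (auto simp del: adjoin_exp.simps)
qed

lemma exp_in_adjoin_exp: "(\<lambda>i x. exp (g i x)) \<in> (\<Union>n. adjoin_exp R g n)"
  using adjoin_expI[OF tame_ring_const[OF R, of "\<lambda>_. 0"]
      adjoin_expI[OF tame_ring_const[OF R, of "\<lambda>_. 1"] adjoin_exp_0], of 0]
  by (auto simp del: adjoin_exp.simps)

end

section \<open>Uniform finiteness for quantifier-free formulas\<close>

lemma or_exp_struct_simps [simp]:
  "universe (or_exp_struct E) = UNIV"
  "add (or_exp_struct E) = (+)" "mul (or_exp_struct E) = (*)" "le (or_exp_struct E) = (\<le>)"
  "cst (or_exp_struct E) c = (case c of OR_Zero \<Rightarrow> 0 | OR_One \<Rightarrow> 1)"
  "app (or_exp_struct E) u = E"
  by (simp_all add: or_exp_struct_def split: or_fun.splits)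

text \<open>Every application of the exponential adjoins one more element. The initial ring is
  arbitrary, so that the second argument of a sum or product can be treated over the ring already
  obtained for the first.\<close>

lemma term_in_tame_ring:
  assumes "tame_ring R" "(\<lambda>e x. x) \<in> R"
  shows "\<exists>R'. tame_ring R' \<and> R \<subseteq> R' \<and> (\<lambda>e x. val real_exp2 (e(k := x)) t) \<in> R'"
  using assms
proof (induction t arbitrary: R)
  case (Var n)
  show ?case
    by (intro exI[of _ R], cases "n = k") (use Var tame_ring_const[OF Var(1), of "\<lambda>e. e n"] in auto)
next
  case (Cst c)
  then show ?case using tame_ring_const by (intro exI[of _ R]) auto
next
  case (App u t)
  then obtain R' where R': "tame_ring R'" "R \<subseteq> R'" "(\<lambda>e x. val real_exp2 (e(k := x)) t) \<in> R'"
    by meson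
  \<comment> \<open>\<open>2 powr x\<close> is \<open>exp (x * ln 2)\<close>, and
    \<open>ln 2\<close> is a constant of the ring.\<close>
  define g where "g = (\<lambda>e x. val real_exp2 (e(k := x)) t * ln 2)"
  have g: "g \<in> R'" unfolding g_def
    by (intro tame_ring_mult[OF R'(1)] tame_ring_const[OF R'(1)] R'(3))
  have eq: "(\<lambda>e x. val real_exp2 (e(k := x)) (App u t)) = (\<lambda>e x. exp (g e x))"
    by (simp add: g_def real_exp2_def powr_def)
  show ?case
    unfolding eq
    using tame_ring_adjoin_exp[OF R'(1) g] exp_in_adjoin_exp[OF R'(1) g]
      order_trans[OF R'(2) subset_adjoin_exp[OF R'(1) g]]
    by blast
next
  case (Add s t)
  obtain R' where R': "tame_ring R'" "R \<subseteq> R'" "(\<lambda>e x. val real_exp2 (e(k := x)) s) \<in> R'"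
    using Add.IH(1)[OF Add.prems] by blast
  then obtain R'' where "tame_ring R''" "R' \<subseteq> R''" "(\<lambda>e x. val real_exp2 (e(k := x)) t) \<in> R''"
    using Add.IH(2)[of R'] Add.prems by blast
  with R' show ?case
    by (intro exI[of _ R'']) (auto simp: real_exp2_def simp del: fun_upd_apply intro!: tame_ring_add)
next
  case (Mul s t)
  obtain R' where R': "tame_ring R'" "R \<subseteq> R'" "(\<lambda>e x. val real_exp2 (e(k := x)) s) \<in> R'"
    using Mul.IH(1)[OF Mul.prems] by blast
  then obtain R'' where "tame_ring R''" "R' \<subseteq> R''" "(\<lambda>e x. val real_exp2 (e(k := x)) t) \<in> R''"
    using Mul.IH(2)[of R'] Mul.prems by blast
  with R' show ?case
    by (intro exI[of _ R'']) (auto simp: real_exp2_def simp del: fun_upd_apply intro!: tame_ring_mult)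
qed

text \<open>Serves the atomic formulas: the truth of \<open>Eq s t\<close> and of
  \<open>Le s t\<close> depends only on the sign of this difference.\<close>

lemma uniformly_tame_diff:
  "uniformly_tame (\<lambda>e x. sgn (val real_exp2 (e(k := x)) s - val real_exp2 (e(k := x)) t))"
proof -
  obtain R where R: "tame_ring R" "poly_families \<subseteq> R" "(\<lambda>e x. val real_exp2 (e(k := x)) s) \<in> R"
    using term_in_tame_ring[OF tame_ring_poly_families id_in_poly_families] by blast
  then obtain R' where R': "tame_ring R'" "R \<subseteq> R'" "(\<lambda>e x. val real_exp2 (e(k := x)) t) \<in> R'"
    using term_in_tame_ring[of R] id_in_poly_families by blast
  have "(\<lambda>e x. val real_exp2 (e(k := x)) s + - val real_exp2 (e(k := x)) t) \<in> R'"
    by (intro tame_ring_add[OF R'(1)] tame_ring_uminus[OF R'(1)]) (use R R' in auto)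
  from tame_ring_tame[OF R'(1) this] show ?thesis by simp
qed

lemma uniformly_tame_sat:
  "quantifier_free p \<Longrightarrow> uniformly_tame (\<lambda>e x. sat real_exp2 (e(k := x)) p)"
proof (induction p)
  case (Eq s t)
  show ?case
    using uniformly_tame_comp[OF uniformly_tame_diff[of k s t], of "\<lambda>r. r = 0"]
    by (simp add: sgn_zero_iff del: fun_upd_apply)
next
  case (Le s t)
  show ?case
    using uniformly_tame_comp[OF uniformly_tame_diff[of k s t], of "\<lambda>r. r \<le> 0"]
    by (simp add: real_exp2_def del: fun_upd_apply)
next
  case (Neg p)
  then show ?case using uniformly_tame_comp[of _ Not] by simp
next
  case (Conj p q)
  then show ?case using uniformly_tame_comp2[of _ _ "(\<and>)"] by simp
next
  case (Disj p q)
  then show ?case using uniformly_tame_comp2[of _ _ "(\<or>)"] by simp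
next
  case (Imp p q)
  then show ?case using uniformly_tame_comp2[of _ _ "(\<longrightarrow>)"] by simp
qed simp_all

section \<open>Transfer along the complete theory\<close>

lemma finite_vars_trm: "finite (vars_trm t)"
  by (induction t) auto

lemma finite_free_vars: "finite (free_vars p)"
  by (induction p) (auto simp: finite_vars_trm)

lemma val_cong: "(\<And>n. n \<in> vars_trm t \<Longrightarrow> e n = e' n) \<Longrightarrow> val A e t = val A e' t"
  by (induction t) auto

lemma sat_cong:
  "(\<And>n. n \<in> free_vars p \<Longrightarrow> e n = e' n) \<Longrightarrow> sat A e p \<longleftrightarrow> sat A e' p"
proof (induction p arbitrary: e e')
  case (Eq s t)
  then have "val A e s = val A e' s" "val A e t = val A e' t" by (auto intro!: val_cong)
  then show ?case by simp
next
  case (Le s t)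
  then have "val A e s = val A e' s" "val A e t = val A e' t" by (auto intro!: val_cong)
  then show ?case by simp
next
  case (Neg p)
  then show ?case by (metis free_vars.simps(3) sat.simps(3))
next
  case (Conj p q)
  then have "sat A e p = sat A e' p" "sat A e q = sat A e' q" by (metis Conj UnCI free_vars.simps(4))+
  then show ?case by simp
next
  case (Disj p q)
  then have "sat A e p = sat A e' p" "sat A e q = sat A e' q" by (metis Disj UnCI free_vars.simps(5))+
  then show ?case by simp
next
  case (Imp p q)
  then have "sat A e p = sat A e' p" "sat A e q = sat A e' q" by (metis Imp UnCI free_vars.simps(6))+
  then show ?case by simp
next
  case (All n p)
  have "sat A (e(n := a)) p \<longleftrightarrow> sat A (e'(n := a)) p" for a
    by (rule All.IH) (use All.prems in auto)
  then show ?case by simp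
next
  case (Ex n p)
  have "sat A (e(n := a)) p \<longleftrightarrow> sat A (e'(n := a)) p" for a
    by (rule Ex.IH) (use Ex.prems in auto)
  then show ?case by simp
qed

lemma val_subst: "val A e (subst_trm x r t) = val A (e(x := val A e r)) t"
  by (induction t) auto

lemma sat_subst:
  "quantifier_free p \<Longrightarrow> sat A e (subst x r p) \<longleftrightarrow> sat A (e(x := val A e r)) p"
  by (induction p) (auto simp: val_subst)

lemma free_vars_foldr_All: "free_vars (foldr All ns p) = free_vars p - set ns"
  by (induction ns) auto

lemma sat_foldr_All:
  assumes "universe A = UNIV"
  shows "(\<forall>e. sat A e (foldr All ns p)) \<longleftrightarrow> (\<forall>e. sat A e p)"
  by (induction ns) (auto simp: assms, metis fun_upd_triv)

lemma sat_foldr_Ex: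
  assumes "universe A = UNIV"
  shows "sat A e (foldr Ex ns p) \<longleftrightarrow> (\<exists>e'. (\<forall>n. n \<notin> set ns \<longrightarrow> e' n = e n) \<and> sat A e' p)"
proof (induction ns arbitrary: e)
  case Nil
  have "e' = e" if "\<forall>n. e' n = e n" for e' using that by auto
  then show ?case by auto
next
  case (Cons m ns)
  show ?case
  proof
    assume "sat A e (foldr Ex (m # ns) p)"
    then obtain a e' where "\<forall>n. n \<notin> set ns \<longrightarrow> e' n = (e(m := a)) n" "sat A e' p"
      using Cons.IH assms by auto
    then show "\<exists>e'. (\<forall>n. n \<notin> set (m # ns) \<longrightarrow> e' n = e n) \<and> sat A e' p"
      by (intro exI[of _ e']) auto
  next
    assume "\<exists>e'. (\<forall>n. n \<notin> set (m # ns) \<longrightarrow> e' n = e n) \<and> sat A e' p"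
    then obtain e' where e': "\<forall>n. n \<notin> set (m # ns) \<longrightarrow> e' n = e n" "sat A e' p" by blast
    then have "sat A (e(m := e' m)) (foldr Ex ns p)" unfolding Cons.IH by (intro exI[of _ e']) auto
    then show "sat A e (foldr Ex (m # ns) p)" using assms by auto
  qed
qed

text \<open>Here \<open>K\<close> bounds the variables of \<open>p\<close>: variables \<open>K\<close> and \<open>K + 1\<close> are the ends of an interval
  and the next \<open>N\<close> variables are the exceptional points.\<close>

definition tame_fm :: "nat \<Rightarrow> nat \<Rightarrow> nat \<Rightarrow> ('c, 'u) fm \<Rightarrow> ('c, 'u) fm" where
  "tame_fm N K k p =
     foldr Ex [K + 2..<K + 2 + N]
       (All K (All (K + 1)
         (Imp (Le (Var K) (Var (K + 1)))
           (foldr (\<lambda>s. Imp (Neg (Conj (Le (Var K) (Var s)) (Le (Var s) (Var (K + 1))))))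
             [K + 2..<K + 2 + N]
             (Iff (subst k (Var K) p) (subst k (Var (K + 1)) p))))))"

lemma sat_foldr_Imp: "sat A e (foldr (\<lambda>s. Imp (f s)) ss q) \<longleftrightarrow> (\<forall>s\<in>set ss. sat A e (f s)) \<longrightarrow> sat A e q"
  by (induction ss) auto

lemma sat_tame_fm:
  assumes qf: "quantifier_free p" and K: "\<And>n. n \<in> free_vars p \<Longrightarrow> n < K"
  shows "sat (or_exp_struct E) e (tame_fm N K k p) \<longleftrightarrow>
    (\<exists>S. finite S \<and> card S \<le> N \<and> const_off S (\<lambda>a. sat (or_exp_struct E) (e(k := a)) p))"
    (is "_ \<longleftrightarrow> ?rhs")
proof -
  let ?A = "or_exp_struct E" and ?I = "{K + 2..<K + 2 + N}"
  have upd: "sat ?A ((e'(K := u, K + 1 := v))(k := w)) p \<longleftrightarrow> sat ?A (e(k := w)) p"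
    if "\<forall>n. n \<notin> ?I \<longrightarrow> e' n = e n" for e' u v w
    by (rule sat_cong) (use that K in \<open>auto dest!: K\<close>)
  have "sat ?A e (tame_fm N K k p) \<longleftrightarrow>
      (\<exists>e'. (\<forall>n. n \<notin> ?I \<longrightarrow> e' n = e n) \<and> const_off (e' ` ?I) (\<lambda>a. sat ?A (e(k := a)) p))"
    unfolding tame_fm_def sat_foldr_Ex[OF or_exp_struct_simps(1)]
  proof (intro ex_cong1 conj_cong)
    fix e' assume e': "\<forall>n. n \<notin> ?I \<longrightarrow> e' n = e n"
    let ?body = "Imp (Le (Var K) (Var (K + 1)))
      (foldr (\<lambda>s. Imp (Neg (Conj (Le (Var K) (Var s)) (Le (Var s) (Var (K + 1))))))
        [K + 2..<K + 2 + N]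
        (Iff (subst k (Var K) p) (subst k (Var (K + 1)) p)))"
    have body: "sat ?A (e'(K := u, K + 1 := v)) ?body \<longleftrightarrow> (u \<le> v \<longrightarrow> {u..v} \<inter> e' ` ?I = {} \<longrightarrow>
        sat ?A (e(k := u)) p = sat ?A (e(k := v)) p)" for u v
    proof -
      define e2 where "e2 = e'(K := u, K + 1 := v)"
      have e2: "e2 K = u" "e2 (K + 1) = v" and pts: "\<And>s. s \<in> ?I \<Longrightarrow> e2 s = e' s"
        by (auto simp: e2_def)
      have "{u..v} \<inter> e' ` ?I = {} \<longleftrightarrow> (\<forall>s\<in>?I. \<not> (u \<le> e' s \<and> e' s \<le> v))"
        by auto
      also have "\<dots> \<longleftrightarrow> (\<forall>s\<in>set [K + 2..<K + 2 + N]. \<not> (u \<le> e2 s \<and> e2 s \<le> v))"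
        using pts by (simp only: set_upt) metis
      finally have disj: "{u..v} \<inter> e' ` ?I = {} \<longleftrightarrow>
        (\<forall>s\<in>set [K + 2..<K + 2 + N]. \<not> (u \<le> e2 s \<and> e2 s \<le> v))" .
      have "sat ?A (e2(k := w)) p \<longleftrightarrow> sat ?A (e(k := w)) p" for w
        unfolding e2_def by (rule upd[OF e'])
      then show ?thesis
        unfolding e2_def[symmetric] disj
        by (simp only: sat.simps val.simps sat_foldr_Imp sat_subst[OF qf] or_exp_struct_simps e2) blast
    qed
    show "sat ?A e' (All K (All (K + 1) ?body)) \<longleftrightarrow>
        const_off (e' ` ?I) (\<lambda>a. sat ?A (e(k := a)) p)"
      unfolding sat.simps(7) body const_off_def by simp
  qed auto
  also have "\<dots> \<longleftrightarrow> ?rhs"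
  proof
    assume "\<exists>e'. (\<forall>n. n \<notin> ?I \<longrightarrow> e' n = e n) \<and> const_off (e' ` ?I) (\<lambda>a. sat ?A (e(k := a)) p)"
    then obtain e' where "const_off (e' ` ?I) (\<lambda>a. sat ?A (e(k := a)) p)" by blast
    moreover have "card (e' ` ?I) \<le> N" using card_image_le[of ?I e'] by simp
    ultimately show ?rhs by blast
  next
    assume ?rhs
    then obtain S where S: "finite S" "card S \<le> N" "const_off S (\<lambda>a. sat ?A (e(k := a)) p)" by blast
    obtain xs where xs: "set xs = S" "length xs = card S"
      using finite_distinct_list[OF S(1)] by (metis distinct_card)
    \<comment> \<open>The first \<open>card S\<close> slots list \<open>S\<close>; the others keep
      their values under \<open>e\<close>, which only enlarges the exceptional set.\<close>
    define e' where "e' n = (if n \<in> {K + 2..<K + 2 + length xs} then xs ! (n - (K + 2)) else e n)" for n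
    have "S \<subseteq> e' ` ?I"
    proof
      fix s assume "s \<in> S"
      then obtain i where "i < length xs" "s = xs ! i" using xs(1) by (metis in_set_conv_nth)
      then have "s = e' (K + 2 + i)" "K + 2 + i \<in> ?I" using xs(2) S(2) by (auto simp: e'_def)
      then show "s \<in> e' ` ?I" by blast
    qed
    from const_off_mono[OF S(3) this]
    show "\<exists>e'. (\<forall>n. n \<notin> ?I \<longrightarrow> e' n = e n) \<and> const_off (e' ` ?I) (\<lambda>a. sat ?A (e(k := a)) p)"
      using xs(2) S(2) by (intro exI[of _ e']) (auto simp: e'_def)
  qed
  finally show ?thesis .
qed

text \<open>The complete theory contains only sentences, so the universal closure of
  \<open>p\<close> is what passes to the model, where it is instantiated again.\<close>

lemma sat_transfer:
  fixes E :: "'a::linordered_field \<Rightarrow> 'a"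
  assumes "is_model (or_exp_struct E) (complete_theory real_exp2)" and "\<And>e. sat real_exp2 e p"
  shows "sat (or_exp_struct E) e p"
proof -
  obtain ns where ns: "set ns = free_vars p" using finite_list[OF finite_free_vars] by blast
  have "\<forall>e. sat real_exp2 e (foldr All ns p)"
    using assms(2) sat_foldr_All[of real_exp2] by (simp add: real_exp2_def)
  then have "foldr All ns p \<in> complete_theory real_exp2"
    by (simp add: complete_theory_def sentence_def true_in_def free_vars_foldr_All ns)
  then have "\<forall>e. sat (or_exp_struct E) e (foldr All ns p)"
    using assms(1) by (auto simp: is_model_def true_in_def)
  then show ?thesis using sat_foldr_All[of "or_exp_struct E"] by simp
qed

text \<open>Over the reals \<open>tame_fm\<close> holds under every assignment with one and the same
  \<open>N\<close>, hence it transfers.\<close>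

lemma const_off_sat_model:
  fixes E :: "'a::linordered_field \<Rightarrow> 'a"
  assumes model: "is_model (or_exp_struct E) (complete_theory real_exp2)" and qf: "quantifier_free p"
  shows "\<exists>S. finite S \<and> const_off S (\<lambda>a. sat (or_exp_struct E) (e(k := a)) p)"
proof -
  obtain N where N: "\<And>e. \<exists>S. finite S \<and> card S \<le> N \<and> const_off S (\<lambda>x. sat real_exp2 (e(k := x)) p)"
    using uniformly_tame_sat[OF qf, of k] unfolding uniformly_tame_def by blast
  obtain K where "\<forall>n\<in>free_vars p. n < K"
    using finite_free_vars finite_nat_set_iff_bounded by blast
  then have K: "\<And>n. n \<in> free_vars p \<Longrightarrow> n < K" by blast
  have "sat real_exp2 e (tame_fm N K k p)" for e
    using N[of e] sat_tame_fm[OF qf K] unfolding real_exp2_def by blast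
  from sat_transfer[OF model this, of e] show ?thesis
    using sat_tame_fm[OF qf K] by blast
qed

section \<open>Open induction in an exponential integer part\<close>

text \<open>The failures of \<open>P\<close> need not have a least element, as \<open>M\<close> may
  be nonstandard. The descent is instead on the number of exceptional points up to the failure,
  which is a natural number.\<close>

lemma integer_part_induct:
  fixes M :: "'a::linordered_field set"
  assumes M: "discretely_ordered_subring M" "integer_part M"
    and S: "finite S" "const_off S P"
    and zero: "P 0" and step: "\<And>a. a \<in> nonneg_part M \<Longrightarrow> P a \<Longrightarrow> P (a + 1)"
    and b: "b \<in> nonneg_part M"
  shows "P b"
proof (rule ccontr)
  have diff: "x - y \<in> M" if "x \<in> M" "y \<in> M" for x y
    using M(1) that unfolding discretely_ordered_subring_def by (metis add_uminus_conv_diff)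
  have one: "1 \<in> M" using M(1) by (simp add: discretely_ordered_subring_def)
  have gap: "x + 1 \<le> y" if "x \<in> M" "y \<in> M" "x < y" for x y
  proof -
    have "1 \<le> y - x"
      using M(1) diff[OF that(2,1)] that(3) unfolding discretely_ordered_subring_def by simp
    then show ?thesis by (simp add: algebra_simps)
  qed
  have pred: "x - 1 \<in> nonneg_part M \<and> \<not> P (x - 1)" if "x \<in> nonneg_part M" "\<not> P x" for x
  proof -
    have "0 < x" using that zero by (auto simp: nonneg_part_def less_le)
    then have "x - 1 \<in> nonneg_part M"
      using that(1) gap[of 0 x] M(1) diff[of x 1] one
      by (auto simp: nonneg_part_def discretely_ordered_subring_def)
    then show ?thesis using step[of "x - 1"] that(2) by auto
  qed
  assume "\<not> P b"
  with b show False
  proof (induction "card {s \<in> S. s \<le> b}" arbitrary: b rule: less_induct)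
    case less
    have b: "b \<in> M" "0 \<le> b" using less.prems by (auto simp: nonneg_part_def)
    let ?T = "{s \<in> S. 0 \<le> s \<and> s \<le> b}"
    have fin: "finite ?T" using S(1) by simp
    \<comment> \<open>\<open>P\<close> holds at 0 and fails at \<open>b\<close>, so an exceptional
      point lies between them and the maximum \<open>s\<close> exists.\<close>
    have "{0..b} \<inter> S \<noteq> {}"
      using const_offD[OF S(2) b(2)] zero less.prems(2) by blast
    then have "?T \<noteq> {}" by auto
    define s where "s = Max ?T"
    have s: "s \<in> S" "0 \<le> s" "s \<le> b" using Max_in[OF fin \<open>?T \<noteq> {}\<close>] by (auto simp: s_def)
    have s_max: "t \<le> s" if "t \<in> S" "0 \<le> t" "t \<le> b" for t
      using Max_ge[OF fin, of t] that by (auto simp: s_def)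
    obtain m where m: "m \<in> M" "m \<le> s" "s < m + 1" using M(2) unfolding integer_part_def by blast
    have "0 \<le> m"
      using gap[of m 0] m s(2) M(1) by (force simp: discretely_ordered_subring_def)
    then have mM: "m \<in> nonneg_part M" using m(1) by (simp add: nonneg_part_def)
    have "\<not> P m"
    \<comment> \<open>If \<open>m < b\<close>, no exceptional point lies between
      \<open>m + 1\<close> and \<open>b\<close>, so the failure moves from \<open>b\<close> to
      \<open>m + 1\<close> and then, by the step hypothesis, to \<open>m\<close>. Otherwise
      \<open>m\<close>, \<open>s\<close> and \<open>b\<close> coincide.\<close>
    proof (cases "m < b")
      case True
      have "m + 1 \<le> b" by (rule gap[OF m(1) b(1) True])
      moreover have "{m + 1..b} \<inter> S = {}"
        using s_max m(3) \<open>0 \<le> m\<close> by fastforce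
      ultimately have "\<not> P (m + 1)" using const_offD[OF S(2)] less.prems(2) by blast
      then show ?thesis using step[OF mM] by blast
    next
      case False
      then have "m = b" using m(2) s(3) by simp
      then show ?thesis using less.prems(2) by simp
    qed
    \<comment> \<open>The extra step down matters when \<open>m = s\<close>: then \<open>s\<close>
      would still be counted at \<open>m\<close>, whereas \<open>m - 1 < s\<close> always lowers the
      count.\<close>
    with pred[OF mM] have bad: "m - 1 \<in> nonneg_part M" "\<not> P (m - 1)" by auto
    have "m - 1 < s" using m(2) by (simp add: algebra_simps less_le_trans[of _ m] order_le_less_trans)
    then have "{t \<in> S. t \<le> m - 1} \<subseteq> {t \<in> S. t \<le> b}" "s \<notin> {t \<in> S. t \<le> m - 1}"
      "s \<in> {t \<in> S. t \<le> b}"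
      using s by auto
    then have "{t \<in> S. t \<le> m - 1} \<subset> {t \<in> S. t \<le> b}" by blast
    then have "card {t \<in> S. t \<le> m - 1} < card {t \<in> S. t \<le> b}"
      using S(1) by (intro psubset_card_mono) auto
    from less.hyps[OF this bad] show False .
  qed
qed

section \<open>Translation of arithmetic formulas into the language of the ordered field\<close>

primrec or_trm :: "ar_trm \<Rightarrow> (or_const, or_fun) trm" where
  "or_trm (Var n) = Var n"
| "or_trm (Cst c) = Cst OR_Zero"
| "or_trm (App u t) =
     (case u of AR_Succ \<Rightarrow> Add (or_trm t) (Cst OR_One) | AR_Exp \<Rightarrow> App OR_Exp (or_trm t))"
| "or_trm (Add s t) = Add (or_trm s) (or_trm t)"
| "or_trm (Mul s t) = Mul (or_trm s) (or_trm t)"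

primrec or_fm :: "ar_fm \<Rightarrow> (or_const, or_fun) fm" where
  "or_fm (Eq s t) = Eq (or_trm s) (or_trm t)"
| "or_fm (Le s t) = Le (or_trm s) (or_trm t)"
| "or_fm (Neg p) = Neg (or_fm p)"
| "or_fm (Conj p q) = Conj (or_fm p) (or_fm q)"
| "or_fm (Disj p q) = Disj (or_fm p) (or_fm q)"
| "or_fm (Imp p q) = Imp (or_fm p) (or_fm q)"
| "or_fm (All n p) = All n (or_fm p)"
| "or_fm (Ex n p) = Ex n (or_fm p)"

lemma nonneg_exp_struct_simps [simp]:
  "universe (nonneg_exp_struct M E) = nonneg_part M"
  "add (nonneg_exp_struct M E) = (+)" "mul (nonneg_exp_struct M E) = (*)"
  "le (nonneg_exp_struct M E) = (\<le>)"
  "cst (nonneg_exp_struct M E) c = 0"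
  "app (nonneg_exp_struct M E) AR_Succ = (\<lambda>x. x + 1)"
  "app (nonneg_exp_struct M E) AR_Exp = E"
  by (simp_all add: nonneg_exp_struct_def split: ar_const.splits)

lemma val_or_trm: "val (or_exp_struct E) e (or_trm t) = val (nonneg_exp_struct M E) e t"
  by (induction t) (auto split: ar_fun.splits)

lemma quantifier_free_or_fm: "quantifier_free p \<Longrightarrow> quantifier_free (or_fm p)"
  by (induction p) auto

text \<open>The two structures share their operations and order and differ only in the universe,
  which nothing but a quantifier consults.\<close>

lemma sat_or_fm:
  "quantifier_free p \<Longrightarrow> sat (or_exp_struct E) e (or_fm p) \<longleftrightarrow> sat (nonneg_exp_struct M E) e p"
  by (induction p) (auto simp: val_or_trm[of E e _ M])

section \<open>The axioms of open induction in the nonnegative part\<close>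

theorem theorem2p1:
  fixes E :: "'a::linordered_field \<Rightarrow> 'a" and M :: "'a set"
  assumes "exponential_field E"
    and "is_model (or_exp_struct E) (complete_theory real_exp2)"
    and "discretely_ordered_subring M"
    and "exponential_integer_part M E"
  shows "is_model (nonneg_exp_struct M E) IOpen_exp"
proof -
  let ?A = "nonneg_exp_struct M E" and ?N = "nonneg_part M"
  have E_add: "E (x + y) = E x * E y" for x y
    using assms(1) by (simp add: exponential_field_def)
  have "E x > 0" for x
    using assms(1) unfolding exponential_field_def bij_betw_def by blast
  \<comment> \<open>By additivity \<open>E 0\<close> equals its own square, and it is
    positive.\<close>
  then have E_0: "E 0 = 1" using E_add[of 0 0] by (simp add: less_le)
  \<comment> \<open>The base of \<open>E\<close> is fixed by the theory of the reals with base 2,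
    where this equation is true; (E2) rests on it.\<close>
  have "sat (or_exp_struct E) (\<lambda>_. 0) (Eq (App OR_Exp (Cst OR_One)) (Add (Cst OR_One) (Cst OR_One)))"
    by (rule sat_transfer[OF assms(2)]) (simp add: real_exp2_def)
  then have E_1: "E 1 = 1 + 1" by simp
  have closed: "0 \<in> ?N" "\<And>x y. x \<in> ?N \<Longrightarrow> y \<in> ?N \<Longrightarrow> x + y \<in> ?N \<and> x * y \<in> ?N"
    "\<And>x. x \<in> ?N \<Longrightarrow> x + 1 \<in> ?N" "\<And>x. x \<in> ?N \<Longrightarrow> E x \<in> ?N"
    using assms(3,4)
    by (auto simp: nonneg_part_def discretely_ordered_subring_def exponential_integer_part_def)
  have diff: "y - x \<in> ?N" if "x \<in> ?N" "y \<in> ?N" "x \<le> y" for x y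
    using assms(3) that unfolding nonneg_part_def discretely_ordered_subring_def
    by (simp, metis add_uminus_conv_diff)
  have ge_1: "1 \<le> x" if "x \<in> ?N" "x \<noteq> 0" for x
    using assms(3) that by (auto simp: nonneg_part_def discretely_ordered_subring_def)
  have one: "1 \<in> ?N" using closed(3)[OF closed(1)] by simp
  have nonneg: "0 \<le> x" if "x \<in> ?N" for x using that by (simp add: nonneg_part_def)
  have is_struct: "is_structure ?A"
    unfolding is_structure_def
  proof (intro conjI allI ballI)
    show "app ?A u x \<in> universe ?A" if "x \<in> universe ?A" for u x
      using closed that by (cases u) auto
  qed (use closed in auto)
  have ind: "true_in ?A (induction_axiom x p)" if qf: "quantifier_free p" for x p
    unfolding true_in_def
  proof (intro allI impI)
    fix e
    \<comment> \<open>Here \<open>a\<close> ranges over the whole field, not only over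
      \<open>M\<close>: the exceptional points are field elements, and the descent takes their
      integer parts.\<close>
    obtain S where S: "finite S" "const_off S (\<lambda>a. sat ?A (e(x := a)) p)"
      using const_off_sat_model[OF assms(2) quantifier_free_or_fm[OF qf], of e x]
      unfolding sat_or_fm[OF qf, of E _ M] by blast
    have "integer_part M" using assms(4) by (simp add: exponential_integer_part_def)
    from integer_part_induct[OF assms(3) this S]
    show "sat ?A e (induction_axiom x p)"
      by (auto simp: induction_axiom_def sat_subst[OF qf])
  qed
  have "true_in ?A p" if "p \<in> {Q1, Q2, Q3, Q4, Q5, Q6, Q7, Q8, E1, E2}" for p
    unfolding true_in_def
  proof (intro allI impI)
    fix e :: "nat \<Rightarrow> 'a" assume "range e \<subseteq> universe ?A"
    then have e: "e n \<in> ?N" for n by auto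
    have q1: "e 0 + 1 \<noteq> 0" using nonneg[OF e[of 0]] by (metis add_nonneg_pos less_irrefl zero_less_one)
    have q3: "\<exists>y\<in>?N. e 0 = y + 1" if "e 0 \<noteq> 0"
      using diff[OF one e ge_1[OF e that]] by (intro bexI[of _ "e 0 - 1"]) auto
    have q8: "e 0 \<le> e 1 \<longleftrightarrow> (\<exists>r\<in>?N. r + e 0 = e 1)"
    proof
      assume "e 0 \<le> e 1"
      then show "\<exists>r\<in>?N. r + e 0 = e 1"
        using diff[OF e e] by (intro bexI[of _ "e 1 - e 0"]) auto
    next
      assume "\<exists>r\<in>?N. r + e 0 = e 1"
      then show "e 0 \<le> e 1" using nonneg by (metis le_add_same_cancel2)
    qed
    show "sat ?A e p"
      using that q1 q3 q8
      by (auto simp: Q1_def Q2_def Q3_def Q4_def Q5_def Q6_def Q7_def Q8_def E1_def E2_def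
          E_0 E_1 E_add algebra_simps)
  qed
  with ind is_struct show ?thesis by (auto simp: is_model_def IOpen_exp_def)
qed

end
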